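(* Let $R$ be a commutative ring, let $M$ be a $C4^{\ast}$-module over $R$, and let $\mathfrak p\in\operatorname{Spec} R$. Assume: (1) $M$ satisfies submodule lifting at $\mathfrak p$; (2) every submodule $N\le M$ satisfies decomposition lifting at $\mathfrak p$; (3) every submodule $N\le M$ satisfies morphism lifting at $\mathfrak p$. Then $M_{\mathfrak p}$ is a $C4^{\ast}$-module (over $R_{\mathfrak p}$).
   Context: Rings are commutative with identity and modules are unital. A module $M$ is a $C4$-module if for every decomposition $M=A\oplus B$ and every homomorphism $f:A\to B$, the image $\operatorname{Im}(f)$ is isomorphic to a direct summand of $B$. $M$ is a $C4^{\ast}$-module if every submodule of $M$ is a $C4$-module. For a submodule $N\le M$, $N_{\mathfrak p}$ is viewed as an $R_{\mathfrak p}$-submodule of $M_{\mathfrak p}$. An $R$-module $N$ satisfies decomposition lifting at $\mathfrak p$ if for every decomposition $N_{\mathfrak p}=U\oplus V$ there exist submodules $A,B\le N$ with $N=A\oplus B$, $U=A_{\mathfrak p}$, $V=B_{\mathfrak p}$. It satisfies morphism lifting at $\mathfrak p$ if whenever $N=A\oplus B$, every $R_{\mathfrak p}$-homomorphism $g:A_{\mathfrak p}\to B_{\mathfrak p}$ equals $f_{\mathfrak p}$ for some $R$-homomorphism $f:A\to B$. It satisfies submodule lifting at $\mathfrak p$ if for every submodule $X\le N_{\mathfrak p}$ there is a submodule $N'\le N$ with $X=N'_{\mathfrak p}$. *)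

theory Defs
  imports "HOL-Algebra.Module" "HOL-Algebra.Ideal"
begin

section \<open>Homomorphisms, decompositions, C4-modules\<close>

text \<open>A submodule \<open>N\<close> of \<open>M\<close> is a set; as a module in its own right it is \<open>M\<lparr>carrier := N\<rparr>\<close>.\<close>

definition module_hom ::
  "('a, 'r) ring_scheme \<Rightarrow> ('a, 'b, 'm) module_scheme \<Rightarrow> ('a, 'c, 'n) module_scheme \<Rightarrow> ('b \<Rightarrow> 'c) set"
  where "module_hom R M N =
    {f \<in> carrier M \<rightarrow> carrier N.
       (\<forall>x\<in>carrier M. \<forall>y\<in>carrier M. f (x \<oplus>\<^bsub>M\<^esub> y) = f x \<oplus>\<^bsub>N\<^esub> f y) \<and>
       (\<forall>r\<in>carrier R. \<forall>x\<in>carrier M. f (r \<odot>\<^bsub>M\<^esub> x) = r \<odot>\<^bsub>N\<^esub> f x)}"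

definition module_isomorphic ::
  "('a, 'r) ring_scheme \<Rightarrow> ('a, 'b, 'm) module_scheme \<Rightarrow> ('a, 'c, 'n) module_scheme \<Rightarrow> bool"
  where "module_isomorphic R M N \<longleftrightarrow>
    (\<exists>h\<in>module_hom R M N. bij_betw h (carrier M) (carrier N))"

definition internal_direct_sum ::
  "('a, 'r) ring_scheme \<Rightarrow> ('a, 'b, 'm) module_scheme \<Rightarrow> 'b set \<Rightarrow> 'b set \<Rightarrow> bool"
  where "internal_direct_sum R M A B \<longleftrightarrow>
    submodule A R M \<and> submodule B R M \<and> A <+>\<^bsub>M\<^esub> B = carrier M \<and> A \<inter> B = {\<zero>\<^bsub>M\<^esub>}"

definition direct_summand ::
  "('a, 'r) ring_scheme \<Rightarrow> ('a, 'b, 'm) module_scheme \<Rightarrow> 'b set \<Rightarrow> bool"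
  where "direct_summand R M C \<longleftrightarrow> (\<exists>D. internal_direct_sum R M C D)"

definition C4_module :: "('a, 'r) ring_scheme \<Rightarrow> ('a, 'b, 'm) module_scheme \<Rightarrow> bool"
  where "C4_module R M \<longleftrightarrow> module R M \<and>
    (\<forall>A B f. internal_direct_sum R M A B \<longrightarrow>
       f \<in> module_hom R (M\<lparr>carrier := A\<rparr>) (M\<lparr>carrier := B\<rparr>) \<longrightarrow>
       (\<exists>C. direct_summand R (M\<lparr>carrier := B\<rparr>) C \<and>
            module_isomorphic R (M\<lparr>carrier := f ` A\<rparr>) (M\<lparr>carrier := C\<rparr>)))"

definition C4star_module :: "('a, 'r) ring_scheme \<Rightarrow> ('a, 'b, 'm) module_scheme \<Rightarrow> bool"
  where "C4star_module R M \<longleftrightarrow> module R M \<and>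
    (\<forall>N. submodule N R M \<longrightarrow> C4_module R (M\<lparr>carrier := N\<rparr>))"


section \<open>Localization at a prime ideal\<close>

text \<open>
  The fraction \<open>m/s\<close> is the class of \<open>(m, s)\<close> modulo \<open>(m, s) \<sim> (n, t)\<close> iff \<open>u t m = u s n\<close>
  for some \<open>u \<notin> p\<close>.  Operations on classes are unions over representatives; since all
  the united classes coincide, this is the usual well-defined operation
  (see \<open>loc_add_frac\<close>, \<open>loc_smult_frac\<close>, \<open>loc_mult_frac\<close> below).
\<close>

definition loc_rel ::
  "('a, 'r) ring_scheme \<Rightarrow> 'a set \<Rightarrow> ('a, 'b, 'm) module_scheme \<Rightarrow> (('b \<times> 'a) \<times> ('b \<times> 'a)) set"
  where "loc_rel R p M =
    {((m, s), (n, t)) | m s n t.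
       m \<in> carrier M \<and> n \<in> carrier M \<and> s \<in> carrier R - p \<and> t \<in> carrier R - p \<and>
       (\<exists>u\<in>carrier R - p. u \<odot>\<^bsub>M\<^esub> (t \<odot>\<^bsub>M\<^esub> m) = u \<odot>\<^bsub>M\<^esub> (s \<odot>\<^bsub>M\<^esub> n))}"

definition frac ::
  "('a, 'r) ring_scheme \<Rightarrow> 'a set \<Rightarrow> ('a, 'b, 'm) module_scheme \<Rightarrow> 'b \<Rightarrow> 'a \<Rightarrow> ('b \<times> 'a) set"
  where "frac R p M m s = loc_rel R p M `` {(m, s)}"

definition loc_add ::
  "('a, 'r) ring_scheme \<Rightarrow> 'a set \<Rightarrow> ('a, 'b, 'm) module_scheme \<Rightarrow>
    ('b \<times> 'a) set \<Rightarrow> ('b \<times> 'a) set \<Rightarrow> ('b \<times> 'a) set"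
  where "loc_add R p M X Y =
    (\<Union>(m, s)\<in>X. \<Union>(n, t)\<in>Y. frac R p M (t \<odot>\<^bsub>M\<^esub> m \<oplus>\<^bsub>M\<^esub> s \<odot>\<^bsub>M\<^esub> n) (s \<otimes>\<^bsub>R\<^esub> t))"

definition loc_smult ::
  "('a, 'r) ring_scheme \<Rightarrow> 'a set \<Rightarrow> ('a, 'b, 'm) module_scheme \<Rightarrow>
    ('a \<times> 'a) set \<Rightarrow> ('b \<times> 'a) set \<Rightarrow> ('b \<times> 'a) set"
  where "loc_smult R p M X Y =
    (\<Union>(a, s)\<in>X. \<Union>(m, t)\<in>Y. frac R p M (a \<odot>\<^bsub>M\<^esub> m) (s \<otimes>\<^bsub>R\<^esub> t))"

definition regular_module :: "('a, 'r) ring_scheme \<Rightarrow> ('a, 'a) module"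
  where "regular_module R =
    \<lparr>carrier = carrier R, mult = mult R, one = one R, zero = zero R, add = add R, smult = mult R\<rparr>"

definition loc_ring :: "('a, 'r) ring_scheme \<Rightarrow> 'a set \<Rightarrow> ('a \<times> 'a) set ring"
  where "loc_ring R p = (let Q = regular_module R in
    \<lparr>carrier = (carrier R \<times> (carrier R - p)) // loc_rel R p Q,
     mult = loc_smult R p Q,
     one = frac R p Q \<one>\<^bsub>R\<^esub> \<one>\<^bsub>R\<^esub>,
     zero = frac R p Q \<zero>\<^bsub>R\<^esub> \<one>\<^bsub>R\<^esub>,
     add = loc_add R p Q\<rparr>)"

text \<open>The module record type extends that of rings; its multiplication and unit are irrelevant
  for modules and left unspecified.\<close>

definition loc_module ::
  "('a, 'r) ring_scheme \<Rightarrow> 'a set \<Rightarrow> ('a, 'b, 'm) module_scheme \<Rightarrow> (('a \<times> 'a) set, ('b \<times> 'a) set) module"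
  where "loc_module R p M =
    \<lparr>carrier = (carrier M \<times> (carrier R - p)) // loc_rel R p M,
     mult = undefined,
     one = undefined,
     zero = frac R p M \<zero>\<^bsub>M\<^esub> \<one>\<^bsub>R\<^esub>,
     add = loc_add R p M,
     smult = loc_smult R p M\<rparr>"

text \<open>\<open>loc_submodule R p M N\<close> is the localization of a submodule \<open>N\<close>, viewed inside that of \<open>M\<close>.\<close>

definition loc_submodule ::
  "('a, 'r) ring_scheme \<Rightarrow> 'a set \<Rightarrow> ('a, 'b, 'm) module_scheme \<Rightarrow> 'b set \<Rightarrow> ('b \<times> 'a) set set"
  where "loc_submodule R p M N = {frac R p M n s | n s. n \<in> N \<and> s \<in> carrier R - p}"


section \<open>Lifting properties\<close>

definition submodule_lifting ::
  "('a, 'r) ring_scheme \<Rightarrow> 'a set \<Rightarrow> ('a, 'b, 'm) module_scheme \<Rightarrow> bool"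
  where "submodule_lifting R p N \<longleftrightarrow>
    (\<forall>X. submodule X (loc_ring R p) (loc_module R p N) \<longrightarrow>
       (\<exists>N'. submodule N' R N \<and> X = loc_submodule R p N N'))"

definition decomposition_lifting ::
  "('a, 'r) ring_scheme \<Rightarrow> 'a set \<Rightarrow> ('a, 'b, 'm) module_scheme \<Rightarrow> bool"
  where "decomposition_lifting R p N \<longleftrightarrow>
    (\<forall>U V. internal_direct_sum (loc_ring R p) (loc_module R p N) U V \<longrightarrow>
       (\<exists>A B. internal_direct_sum R N A B \<and>
          U = loc_submodule R p N A \<and> V = loc_submodule R p N B))"

text \<open>The localization \<open>f\<^sub>p\<close> of \<open>f : A \<rightarrow> B\<close> is the map with \<open>f\<^sub>p (a/s) = f(a)/s\<close>; hence the
  equation \<open>g = f\<^sub>p\<close> of maps on the localization of \<open>A\<close> is the last line.\<close>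

definition morphism_lifting ::
  "('a, 'r) ring_scheme \<Rightarrow> 'a set \<Rightarrow> ('a, 'b, 'm) module_scheme \<Rightarrow> bool"
  where "morphism_lifting R p N \<longleftrightarrow>
    (\<forall>A B g. internal_direct_sum R N A B \<longrightarrow>
       g \<in> module_hom (loc_ring R p)
             ((loc_module R p N)\<lparr>carrier := loc_submodule R p N A\<rparr>)
             ((loc_module R p N)\<lparr>carrier := loc_submodule R p N B\<rparr>) \<longrightarrow>
       (\<exists>f\<in>module_hom R (N\<lparr>carrier := A\<rparr>) (N\<lparr>carrier := B\<rparr>).
          \<forall>a\<in>A. \<forall>s\<in>carrier R - p. g (frac R p N a s) = frac R p N (f a) s))"


section \<open>The operations on fractions are well defined\<close>

lemma UN2_const:
  assumes "(a, b) \<in> A" "(c, d) \<in> B"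
    and "\<And>a b c d. (a, b) \<in> A \<Longrightarrow> (c, d) \<in> B \<Longrightarrow> f a b c d = K"
  shows "(\<Union>(a, b)\<in>A. \<Union>(c, d)\<in>B. f a b c d) = K"
  using assms by fast

locale prime_loc = module R M + primeideal p R for R (structure) and M (structure) and p
begin

abbreviation "S \<equiv> carrier R - p"

lemma S_one: "\<one> \<in> S"
  using I_notcarr one_imp_carrier by blast

lemma S_mult: "s \<in> S \<Longrightarrow> t \<in> S \<Longrightarrow> s \<otimes> t \<in> S"
  using I_prime by blast

lemma loc_rel_iff:
  "((m, s), (n, t)) \<in> loc_rel R p M \<longleftrightarrow>
    m \<in> carrier M \<and> n \<in> carrier M \<and> s \<in> S \<and> t \<in> S \<and>
    (\<exists>u\<in>S. u \<odot>\<^bsub>M\<^esub> (t \<odot>\<^bsub>M\<^esub> m) = u \<odot>\<^bsub>M\<^esub> (s \<odot>\<^bsub>M\<^esub> n))"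
  by (simp add: loc_rel_def)

lemma equiv_loc_rel: "equiv (carrier M \<times> S) (loc_rel R p M)"
proof (rule equivI)
  show "loc_rel R p M \<subseteq> (carrier M \<times> S) \<times> carrier M \<times> S"
    by (auto simp: loc_rel_def)
  show "refl_on (carrier M \<times> S) (loc_rel R p M)"
    using S_one by (auto simp: refl_on_def loc_rel_iff)
  show "sym (loc_rel R p M)"
  proof (rule symI)
    fix x y assume "(x, y) \<in> loc_rel R p M"
    then show "(y, x) \<in> loc_rel R p M"
      by (cases x; cases y) (force simp: loc_rel_iff)
  qed
  show "trans (loc_rel R p M)"
  proof (rule transI)
    fix x y z assume 1: "(x, y) \<in> loc_rel R p M" and 2: "(y, z) \<in> loc_rel R p M"
    obtain m s n t l r where xyz: "x = (m, s)" "y = (n, t)" "z = (l, r)"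
      by (metis surj_pair)
    from 1 2 have c: "m \<in> carrier M" "n \<in> carrier M" "l \<in> carrier M" "s \<in> S" "t \<in> S" "r \<in> S"
      by (auto simp: xyz loc_rel_iff)
    from 1 obtain u where u: "u \<in> S" "u \<odot>\<^bsub>M\<^esub> (t \<odot>\<^bsub>M\<^esub> m) = u \<odot>\<^bsub>M\<^esub> (s \<odot>\<^bsub>M\<^esub> n)"
      by (auto simp: xyz loc_rel_iff)
    from 2 obtain v where v: "v \<in> S" "v \<odot>\<^bsub>M\<^esub> (r \<odot>\<^bsub>M\<^esub> n) = v \<odot>\<^bsub>M\<^esub> (t \<odot>\<^bsub>M\<^esub> l)"
      by (auto simp: xyz loc_rel_iff)
    have cs: "s \<in> carrier R" "t \<in> carrier R" "r \<in> carrier R" "u \<in> carrier R" "v \<in> carrier R"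
      using c u v by auto
    have "(u \<otimes> v \<otimes> t) \<odot>\<^bsub>M\<^esub> (r \<odot>\<^bsub>M\<^esub> m) = (v \<otimes> r) \<odot>\<^bsub>M\<^esub> (u \<odot>\<^bsub>M\<^esub> (t \<odot>\<^bsub>M\<^esub> m))"
      using c cs by (simp add: smult_assoc1 [symmetric] m_ac)
    also have "\<dots> = (u \<otimes> s) \<odot>\<^bsub>M\<^esub> (v \<odot>\<^bsub>M\<^esub> (r \<odot>\<^bsub>M\<^esub> n))"
      unfolding u(2) using c cs by (simp add: smult_assoc1 [symmetric] m_ac)
    also have "\<dots> = (u \<otimes> v \<otimes> t) \<odot>\<^bsub>M\<^esub> (s \<odot>\<^bsub>M\<^esub> l)"
      unfolding v(2) using c cs by (simp add: smult_assoc1 [symmetric] m_ac)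
    finally show "(x, z) \<in> loc_rel R p M"
      using c u(1) v(1) S_mult by (auto simp: xyz loc_rel_iff)
  qed
qed

lemma frac_eq_iff:
  assumes "m \<in> carrier M" "n \<in> carrier M" "s \<in> S" "t \<in> S"
  shows "frac R p M m s = frac R p M n t \<longleftrightarrow>
    (\<exists>u\<in>S. u \<odot>\<^bsub>M\<^esub> (t \<odot>\<^bsub>M\<^esub> m) = u \<odot>\<^bsub>M\<^esub> (s \<odot>\<^bsub>M\<^esub> n))"
  using eq_equiv_class_iff [OF equiv_loc_rel, of "(m, s)" "(n, t)"] assms
  by (simp add: frac_def loc_rel_iff)

lemma mem_frac:
  assumes "(n, t) \<in> frac R p M m s"
  shows "n \<in> carrier M" "t \<in> S"
    "\<exists>u\<in>S. u \<odot>\<^bsub>M\<^esub> (t \<odot>\<^bsub>M\<^esub> m) = u \<odot>\<^bsub>M\<^esub> (s \<odot>\<^bsub>M\<^esub> n)"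
  using assms by (auto simp: frac_def loc_rel_iff)

lemma frac_self: "m \<in> carrier M \<Longrightarrow> s \<in> S \<Longrightarrow> (m, s) \<in> frac R p M m s"
  using S_one by (auto simp: frac_def loc_rel_iff)

lemma loc_carrier: "carrier (loc_module R p M) = {frac R p M m s | m s. m \<in> carrier M \<and> s \<in> S}"
  by (auto simp: loc_module_def quotient_def frac_def)

lemma loc_add_frac:
  assumes "m \<in> carrier M" "n \<in> carrier M" "s \<in> S" "t \<in> S"
  shows "loc_add R p M (frac R p M m s) (frac R p M n t) =
    frac R p M (t \<odot>\<^bsub>M\<^esub> m \<oplus>\<^bsub>M\<^esub> s \<odot>\<^bsub>M\<^esub> n) (s \<otimes> t)"
proof -
  have "frac R p M (t' \<odot>\<^bsub>M\<^esub> m' \<oplus>\<^bsub>M\<^esub> s' \<odot>\<^bsub>M\<^esub> n') (s' \<otimes> t') =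
        frac R p M (t \<odot>\<^bsub>M\<^esub> m \<oplus>\<^bsub>M\<^esub> s \<odot>\<^bsub>M\<^esub> n) (s \<otimes> t)"
    if 1: "(m', s') \<in> frac R p M m s" and 2: "(n', t') \<in> frac R p M n t" for m' s' n' t'
  proof -
    note c = assms mem_frac(1,2) [OF 1] mem_frac(1,2) [OF 2]
    obtain u where u: "u \<in> S" "u \<odot>\<^bsub>M\<^esub> (s' \<odot>\<^bsub>M\<^esub> m) = u \<odot>\<^bsub>M\<^esub> (s \<odot>\<^bsub>M\<^esub> m')"
      using mem_frac(3) [OF 1] by blast
    obtain v where v: "v \<in> S" "v \<odot>\<^bsub>M\<^esub> (t' \<odot>\<^bsub>M\<^esub> n) = v \<odot>\<^bsub>M\<^esub> (t \<odot>\<^bsub>M\<^esub> n')"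
      using mem_frac(3) [OF 2] by blast
    have cs: "s \<in> carrier R" "t \<in> carrier R" "s' \<in> carrier R" "t' \<in> carrier R"
      "u \<in> carrier R" "v \<in> carrier R"
      using c u v by auto
    have a: "(u \<otimes> v) \<odot>\<^bsub>M\<^esub> ((s \<otimes> t) \<odot>\<^bsub>M\<^esub> (t' \<odot>\<^bsub>M\<^esub> m')) = (u \<otimes> v) \<odot>\<^bsub>M\<^esub> ((s' \<otimes> t') \<odot>\<^bsub>M\<^esub> (t \<odot>\<^bsub>M\<^esub> m))"
    proof -
      have "(u \<otimes> v) \<odot>\<^bsub>M\<^esub> ((s \<otimes> t) \<odot>\<^bsub>M\<^esub> (t' \<odot>\<^bsub>M\<^esub> m')) = (v \<otimes> t \<otimes> t') \<odot>\<^bsub>M\<^esub> (u \<odot>\<^bsub>M\<^esub> (s \<odot>\<^bsub>M\<^esub> m'))"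
        using c cs by (simp add: smult_assoc1 [symmetric] m_ac)
      also have "\<dots> = (u \<otimes> v) \<odot>\<^bsub>M\<^esub> ((s' \<otimes> t') \<odot>\<^bsub>M\<^esub> (t \<odot>\<^bsub>M\<^esub> m))"
        unfolding u(2) [symmetric] using c cs by (simp add: smult_assoc1 [symmetric] m_ac)
      finally show ?thesis .
    qed
    have b: "(u \<otimes> v) \<odot>\<^bsub>M\<^esub> ((s \<otimes> t) \<odot>\<^bsub>M\<^esub> (s' \<odot>\<^bsub>M\<^esub> n')) = (u \<otimes> v) \<odot>\<^bsub>M\<^esub> ((s' \<otimes> t') \<odot>\<^bsub>M\<^esub> (s \<odot>\<^bsub>M\<^esub> n))"
    proof -
      have "(u \<otimes> v) \<odot>\<^bsub>M\<^esub> ((s \<otimes> t) \<odot>\<^bsub>M\<^esub> (s' \<odot>\<^bsub>M\<^esub> n')) = (u \<otimes> s \<otimes> s') \<odot>\<^bsub>M\<^esub> (v \<odot>\<^bsub>M\<^esub> (t \<odot>\<^bsub>M\<^esub> n'))"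
        using c cs by (simp add: smult_assoc1 [symmetric] m_ac)
      also have "\<dots> = (u \<otimes> v) \<odot>\<^bsub>M\<^esub> ((s' \<otimes> t') \<odot>\<^bsub>M\<^esub> (s \<odot>\<^bsub>M\<^esub> n))"
        unfolding v(2) [symmetric] using c cs by (simp add: smult_assoc1 [symmetric] m_ac)
      finally show ?thesis .
    qed
    have "(u \<otimes> v) \<odot>\<^bsub>M\<^esub> ((s \<otimes> t) \<odot>\<^bsub>M\<^esub> (t' \<odot>\<^bsub>M\<^esub> m' \<oplus>\<^bsub>M\<^esub> s' \<odot>\<^bsub>M\<^esub> n')) =
          (u \<otimes> v) \<odot>\<^bsub>M\<^esub> ((s' \<otimes> t') \<odot>\<^bsub>M\<^esub> (t \<odot>\<^bsub>M\<^esub> m \<oplus>\<^bsub>M\<^esub> s \<odot>\<^bsub>M\<^esub> n))"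
      using a b c cs by (simp add: smult_r_distr)
    then show ?thesis
      using c cs S_mult u(1) v(1) by (subst frac_eq_iff) auto
  qed
  then show ?thesis
    unfolding loc_add_def
    by (intro UN2_const [OF frac_self frac_self]) (use assms in simp_all)
qed

end

lemma module_regular:
  assumes "cring R"
  shows "module R (regular_module R)"
proof -
  interpret cring R by fact
  have "abelian_group (regular_module R)"
    by (rule abelian_groupI)
      (simp_all add: regular_module_def a_ac add.l_inv_ex [simplified])
  then show ?thesis
    by (intro moduleI is_cring) (simp_all add: regular_module_def l_distr r_distr m_assoc)
qed

lemma prime_loc_regular: "primeideal p R \<Longrightarrow> prime_loc R (regular_module R) p"
  by (simp add: prime_loc_def module_regular primeideal.axioms(2))

context prime_loc
begin

lemma loc_smult_frac:
  assumes "a \<in> carrier R" "s \<in> S" "m \<in> carrier M" "t \<in> S"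
  shows "loc_smult R p M (frac R p (regular_module R) a s) (frac R p M m t) =
    frac R p M (a \<odot>\<^bsub>M\<^esub> m) (s \<otimes> t)"
proof -
  interpret Q: prime_loc R "regular_module R" p
    using primeideal_axioms by (rule prime_loc_regular)
  have [simp]: "carrier (regular_module R) = carrier R" "smult (regular_module R) = mult R"
    by (simp_all add: regular_module_def)
  have "frac R p M (a' \<odot>\<^bsub>M\<^esub> m') (s' \<otimes> t') = frac R p M (a \<odot>\<^bsub>M\<^esub> m) (s \<otimes> t)"
    if 1: "(a', s') \<in> frac R p (regular_module R) a s" and 2: "(m', t') \<in> frac R p M m t"
    for a' s' m' t'
  proof -
    note c = assms Q.mem_frac(1,2) [OF 1] mem_frac(1,2) [OF 2]
    obtain u where u: "u \<in> S" "u \<otimes> (s' \<otimes> a) = u \<otimes> (s \<otimes> a')"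
      using Q.mem_frac(3) [OF 1] by auto
    obtain v where v: "v \<in> S" "v \<odot>\<^bsub>M\<^esub> (t' \<odot>\<^bsub>M\<^esub> m) = v \<odot>\<^bsub>M\<^esub> (t \<odot>\<^bsub>M\<^esub> m')"
      using mem_frac(3) [OF 2] by blast
    have cs: "a' \<in> carrier R" "s \<in> carrier R" "t \<in> carrier R" "s' \<in> carrier R" "t' \<in> carrier R"
      "u \<in> carrier R" "v \<in> carrier R"
      using c u v by auto
    have "(u \<otimes> v) \<odot>\<^bsub>M\<^esub> ((s \<otimes> t) \<odot>\<^bsub>M\<^esub> (a' \<odot>\<^bsub>M\<^esub> m')) = (u \<otimes> (s \<otimes> a')) \<odot>\<^bsub>M\<^esub> (v \<odot>\<^bsub>M\<^esub> (t \<odot>\<^bsub>M\<^esub> m'))"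
      using c cs by (simp add: smult_assoc1 [symmetric] m_ac)
    also have "\<dots> = (u \<otimes> v) \<odot>\<^bsub>M\<^esub> ((s' \<otimes> t') \<odot>\<^bsub>M\<^esub> (a \<odot>\<^bsub>M\<^esub> m))"
      unfolding u(2) [symmetric] v(2) [symmetric]
      using c cs by (simp add: smult_assoc1 [symmetric] m_ac)
    finally show ?thesis
      using c cs S_mult u(1) v(1) by (subst frac_eq_iff) auto
  qed
  then show ?thesis
    unfolding loc_smult_def
    by (intro UN2_const [OF Q.frac_self frac_self]) (use assms in simp_all)
qed

end

lemma loc_mult_frac:
  assumes "primeideal p R" "a \<in> carrier R" "b \<in> carrier R" "s \<in> carrier R - p" "t \<in> carrier R - p"
  shows "frac R p (regular_module R) a s \<otimes>\<^bsub>loc_ring R p\<^esub> frac R p (regular_module R) b t =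
    frac R p (regular_module R) (a \<otimes>\<^bsub>R\<^esub> b) (s \<otimes>\<^bsub>R\<^esub> t)"
proof -
  have "mult (loc_ring R p) = loc_smult R p (regular_module R)"
    "carrier (regular_module R) = carrier R" "smult (regular_module R) = mult R"
    by (simp_all add: loc_ring_def Let_def regular_module_def)
  then show ?thesis
    using prime_loc.loc_smult_frac [OF prime_loc_regular [OF assms(1)], of a s b t] assms by simp
qed

end

theory Submission
  imports Defs
begin

text \<open>
  Let \<open>X\<close> be a submodule of \<open>M\<^sub>p\<close>.  Submodule lifting gives \<open>X = N\<^sub>p\<close> for a submodule \<open>N\<close> of
  \<open>M\<close>, and \<open>N\<close> is a C4-module because \<open>M\<close> is a C4*-module.  So it suffices that the C4-property
  passes from \<open>N\<close> to \<open>N\<^sub>p\<close> (\<open>C4_module_loc\<close>).  Suppose \<open>N\<^sub>p = U \<oplus> V\<close> and \<open>g : U \<rightarrow> V\<close>.  By the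
  other two lifting properties this is the localization of a decomposition \<open>N = A \<oplus> B\<close> with a map
  \<open>f : A \<rightarrow> B\<close>.  The C4-property of \<open>N\<close> gives \<open>B = C \<oplus> D\<close> with \<open>f(A) \<cong> C\<close>.  Localization
  preserves direct sums (\<open>internal_direct_sum_loc\<close>), isomorphisms
  (\<open>loc_submodules_isomorphic\<close>) and images, so \<open>V = C\<^sub>p \<oplus> D\<^sub>p\<close> and \<open>g(U) = f(A)\<^sub>p \<cong> C\<^sub>p\<close>.

  There are two versions of \<open>N\<^sub>p\<close>: the lifting properties of \<open>N\<close> speak of the localization of
  \<open>N\<close> as a module of its own, whose fractions are classes of pairs with numerators in \<open>N\<close>, whereas
  \<open>X\<close> consists of classes of pairs with numerators in \<open>M\<close>.  The inclusion of \<open>N\<close> in \<open>M\<close> localizes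
  to an isomorphism between them (\<open>loc_submodule_isomorphic\<close>), and the C4-property is invariant
  under isomorphism (\<open>C4_module_isomorphic\<close>).
\<close>

section \<open>Submodules, homomorphisms and direct sums\<close>

text \<open>Closure under negation comes from closure under scalars, as \<open>-x = (-1) x\<close>.\<close>

lemma (in module) submodule_iff:
  "submodule H R M \<longleftrightarrow> H \<subseteq> carrier M \<and> \<zero>\<^bsub>M\<^esub> \<in> H \<and> (\<forall>x\<in>H. \<forall>y\<in>H. x \<oplus>\<^bsub>M\<^esub> y \<in> H) \<and>
    (\<forall>r\<in>carrier R. \<forall>x\<in>H. r \<odot>\<^bsub>M\<^esub> x \<in> H)" (is "_ \<longleftrightarrow> ?rhs")
proof
  assume H: "submodule H R M"
  then have "subgroup H (add_monoid M)"
    by (rule submodule.axioms(1))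
  then have "\<zero>\<^bsub>M\<^esub> \<in> H"
    using subgroup.one_closed by fastforce
  then show ?rhs
    using submoduleE [OF H] by blast
next
  assume H: ?rhs
  show "submodule H R M"
  proof (rule submoduleI)
    fix x assume x: "x \<in> H"
    then have "\<ominus>\<^bsub>M\<^esub> x = (\<ominus> \<one>) \<odot>\<^bsub>M\<^esub> x"
      using H by (subst smult_l_minus) auto
    then show "\<ominus>\<^bsub>M\<^esub> x \<in> H"
      using H x by simp
  qed (use H in blast)+
qed

lemma (in module) submodule_of_submodule_iff:
  assumes "submodule B R M"
  shows "submodule C R (M\<lparr>carrier := B\<rparr>) \<longleftrightarrow> submodule C R M \<and> C \<subseteq> B"
proof -
  interpret B: module R "M\<lparr>carrier := B\<rparr>"
    using assms module_axioms by (rule submodule.submodule_is_module)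
  show ?thesis
    using assms unfolding submodule_iff B.submodule_iff by auto
qed

text \<open>Both summands lie in their sum because each contains zero; so a decomposition of a submodule
  can be stated in the ambient module alone, and its maps and localizations taken there.\<close>

lemma (in module) internal_direct_sum_submodule_iff:
  assumes B: "submodule B R M"
  shows "internal_direct_sum R (M\<lparr>carrier := B\<rparr>) C D \<longleftrightarrow>
    submodule C R M \<and> submodule D R M \<and> C <+>\<^bsub>M\<^esub> D = B \<and> C \<inter> D = {\<zero>\<^bsub>M\<^esub>}"
proof -
  have sum: "C <+>\<^bsub>M\<lparr>carrier := B\<rparr>\<^esub> D = C <+>\<^bsub>M\<^esub> D"
    by (simp add: set_add_def')
  have "C \<subseteq> B \<and> D \<subseteq> B" if "submodule C R M" "submodule D R M" "C <+>\<^bsub>M\<^esub> D = B"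
  proof -
    have "c \<oplus>\<^bsub>M\<^esub> d \<in> B" if "c \<in> C" "d \<in> D" for c d
      using that \<open>C <+>\<^bsub>M\<^esub> D = B\<close> by (auto simp: set_add_def')
    from this [of _ "\<zero>\<^bsub>M\<^esub>"] this [of "\<zero>\<^bsub>M\<^esub>"] show ?thesis
      using \<open>submodule C R M\<close> \<open>submodule D R M\<close> by (auto simp: submodule_iff subset_iff)
  qed
  then show ?thesis
    unfolding internal_direct_sum_def submodule_of_submodule_iff [OF B] sum by auto
qed

lemma module_hom_mem: "f \<in> module_hom R M N \<Longrightarrow> x \<in> carrier M \<Longrightarrow> f x \<in> carrier N"
  by (auto simp: module_hom_def)

lemma module_hom_add:
  "f \<in> module_hom R M N \<Longrightarrow> x \<in> carrier M \<Longrightarrow> y \<in> carrier M \<Longrightarrow> f (x \<oplus>\<^bsub>M\<^esub> y) = f x \<oplus>\<^bsub>N\<^esub> f y"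
  by (auto simp: module_hom_def)

lemma module_hom_smult:
  "f \<in> module_hom R M N \<Longrightarrow> r \<in> carrier R \<Longrightarrow> x \<in> carrier M \<Longrightarrow> f (r \<odot>\<^bsub>M\<^esub> x) = r \<odot>\<^bsub>N\<^esub> f x"
  by (auto simp: module_hom_def)

lemma module_hom_zero:
  assumes "module R M" "module R N" "f \<in> module_hom R M N"
  shows "f \<zero>\<^bsub>M\<^esub> = \<zero>\<^bsub>N\<^esub>"
proof -
  interpret M: module R M by fact
  interpret N: module R N by fact
  have "f \<zero>\<^bsub>M\<^esub> = f (\<zero>\<^bsub>R\<^esub> \<odot>\<^bsub>M\<^esub> \<zero>\<^bsub>M\<^esub>)"
    by simp
  also have "\<dots> = \<zero>\<^bsub>N\<^esub>"
    using assms(3) by (simp add: module_hom_smult module_hom_mem del: M.smult_l_null M.smult_r_null)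
  finally show ?thesis .
qed

lemma image_submodule:
  assumes "module R M" "module R N" "f \<in> module_hom R M N" "submodule A R M"
  shows "submodule (f ` A) R N"
proof -
  interpret M: module R M by fact
  interpret N: module R N by fact
  note A = assms(4) [unfolded M.submodule_iff]
  have hom: "f x \<oplus>\<^bsub>N\<^esub> f y = f (x \<oplus>\<^bsub>M\<^esub> y)" "f x \<in> carrier N" "r \<odot>\<^bsub>N\<^esub> f x = f (r \<odot>\<^bsub>M\<^esub> x)"
    if "x \<in> A" "y \<in> A" "r \<in> carrier R" for x y r
    using A that assms(3)
    by (simp_all add: module_hom_add module_hom_smult module_hom_mem subsetD [of A "carrier M"])
  have "\<zero>\<^bsub>N\<^esub> = f \<zero>\<^bsub>M\<^esub>"
    using module_hom_zero [OF assms(1-3)] by simp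
  then show ?thesis
    using A hom [OF _ _ M.R.one_closed] hom(3) unfolding N.submodule_iff by auto
qed

lemma image_internal_direct_sum:
  assumes M: "module R M" and N: "module R N"
    and f: "f \<in> module_hom R M N" "inj_on f (carrier M)"
    and L: "submodule L R M" and sum: "internal_direct_sum R (M\<lparr>carrier := L\<rparr>) A B"
  shows "internal_direct_sum R (N\<lparr>carrier := f ` L\<rparr>) (f ` A) (f ` B)"
proof -
  interpret M: module R M by fact
  interpret N: module R N by fact
  from sum have A: "submodule A R M" and B: "submodule B R M"
    and AB: "A <+>\<^bsub>M\<^esub> B = L" "A \<inter> B = {\<zero>\<^bsub>M\<^esub>}"
    unfolding M.internal_direct_sum_submodule_iff [OF L] by auto
  have sub: "A \<subseteq> carrier M" "B \<subseteq> carrier M"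
    using A B by (auto simp: M.submodule_iff)
  have "f ` A <+>\<^bsub>N\<^esub> f ` B = f ` L"
  proof -
    have "f (a \<oplus>\<^bsub>M\<^esub> b) = f a \<oplus>\<^bsub>N\<^esub> f b" if "a \<in> A" "b \<in> B" for a b
      using that sub f(1) by (intro module_hom_add) auto
    then show ?thesis
      unfolding AB(1) [symmetric] set_add_def' by force
  qed
  moreover have "f ` A \<inter> f ` B = {\<zero>\<^bsub>N\<^esub>}"
    using inj_on_image_Int [OF f(2) sub] AB(2) module_hom_zero [OF M N f(1)] by auto
  ultimately show ?thesis
    unfolding N.internal_direct_sum_submodule_iff [OF image_submodule [OF M N f(1) L]]
    using image_submodule [OF M N f(1)] A B by blast
qed

lemma module_isomorphic_image:
  assumes "f \<in> module_hom R M N" "inj_on f (carrier M)" "A \<subseteq> carrier M"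
  shows "module_isomorphic R (M\<lparr>carrier := A\<rparr>) (N\<lparr>carrier := f ` A\<rparr>)"
  unfolding module_isomorphic_def
proof (rule bexI)
  show "bij_betw f (carrier (M\<lparr>carrier := A\<rparr>)) (carrier (N\<lparr>carrier := f ` A\<rparr>))"
    using inj_on_subset [OF assms(2,3)] by (simp add: bij_betw_def)
  show "f \<in> module_hom R (M\<lparr>carrier := A\<rparr>) (N\<lparr>carrier := f ` A\<rparr>)"
    using assms(1,3) by (auto simp: module_hom_def subset_iff)
qed

lemma module_isomorphic_trans:
  assumes "module_isomorphic R L M" "module_isomorphic R M N"
  shows "module_isomorphic R L N"
proof -
  from assms obtain f g where f: "f \<in> module_hom R L M" "bij_betw f (carrier L) (carrier M)"
    and g: "g \<in> module_hom R M N" "bij_betw g (carrier M) (carrier N)"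
    unfolding module_isomorphic_def by blast
  have "g \<circ> f \<in> module_hom R L N"
    using f(1) g(1) by (auto simp: module_hom_def Pi_iff)
  then show ?thesis
    using bij_betw_trans [OF f(2) g(2)] unfolding module_isomorphic_def by blast
qed

lemma inverse_module_hom:
  assumes "module R M" "f \<in> module_hom R M N" "bij_betw f (carrier M) (carrier N)"
  shows "the_inv_into (carrier M) f \<in> module_hom R N M"
proof -
  interpret M: module R M by fact
  let ?g = "the_inv_into (carrier M) f"
  have inj: "inj_on f (carrier M)" and im: "f ` carrier M = carrier N"
    using assms(3) by (auto simp: bij_betw_def)
  have g: "?g y \<in> carrier M" "f (?g y) = y" if "y \<in> carrier N" for y
    using that inj im by (auto intro: the_inv_into_into f_the_inv_into_f)
  have eq: "?g y = x" if "x \<in> carrier M" "f x = y" for x y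
    using that inj by (auto intro: the_inv_into_f_eq)
  have "?g (x \<oplus>\<^bsub>N\<^esub> y) = ?g x \<oplus>\<^bsub>M\<^esub> ?g y" if "x \<in> carrier N" "y \<in> carrier N" for x y
    by (rule eq) (use g that assms(2) in \<open>auto simp: module_hom_add\<close>)
  moreover have "?g (r \<odot>\<^bsub>N\<^esub> x) = r \<odot>\<^bsub>M\<^esub> ?g x" if "r \<in> carrier R" "x \<in> carrier N" for r x
    by (rule eq) (use g that assms(2) in \<open>auto simp: module_hom_smult\<close>)
  ultimately show ?thesis
    using g(1) by (auto simp: module_hom_def)
qed

lemma module_isomorphic_sym:
  assumes "module R M" "module_isomorphic R M N"
  shows "module_isomorphic R N M"
  using assms inverse_module_hom bij_betw_the_inv_into unfolding module_isomorphic_def by meson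

text \<open>Along an isomorphism \<open>h\<close> with inverse \<open>k\<close>, a decomposition of the target and a map
  \<open>f\<close> between its parts pull back to the source, where the property yields a summand; the image
  of that summand under \<open>h\<close> answers the original question.\<close>

lemma C4_module_isomorphic:
  assumes C4: "C4_module R M" and N: "module R N" and iso: "module_isomorphic R M N"
  shows "C4_module R N"
proof -
  have M: "module R M"
    using C4 by (simp add: C4_module_def)
  interpret M: module R M by (rule M)
  interpret N: module R N by (rule N)
  obtain h where h: "h \<in> module_hom R M N" "bij_betw h (carrier M) (carrier N)"
    using iso by (auto simp: module_isomorphic_def)
  define k where "k = the_inv_into (carrier M) h"
  have k: "k \<in> module_hom R N M" "bij_betw k (carrier N) (carrier M)"
    unfolding k_def using inverse_module_hom [OF M h] bij_betw_the_inv_into [OF h(2)] by auto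
  have hk: "h (k y) = y" if "y \<in> carrier N" for y
    unfolding k_def using h(2) that by (intro f_the_inv_into_f_bij_betw) auto
  have inj: "inj_on h (carrier M)" "inj_on k (carrier N)"
    and onto: "k ` carrier N = carrier M"
    using h(2) k(2) by (auto simp: bij_betw_def)
  have "\<exists>C. direct_summand R (N\<lparr>carrier := B\<rparr>) C \<and>
            module_isomorphic R (N\<lparr>carrier := f ` A\<rparr>) (N\<lparr>carrier := C\<rparr>)"
    if AB: "internal_direct_sum R N A B"
      and f: "f \<in> module_hom R (N\<lparr>carrier := A\<rparr>) (N\<lparr>carrier := B\<rparr>)" for A B f
  proof -
    have sub: "submodule A R N" "submodule B R N"
      using AB by (auto simp: internal_direct_sum_def)
    then have subset: "A \<subseteq> carrier N" "B \<subseteq> carrier N"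
      by (auto simp: N.submodule_iff)
    have fA: "f ` A \<subseteq> B"
      using f by (auto simp: module_hom_def)
    let ?f = "k \<circ> f \<circ> h"
    have hkA: "h ` k ` A = A" and hkB: "h ` k ` B = B"
      using subset hk by (force simp: image_image)+
    have sum: "internal_direct_sum R M (k ` A) (k ` B)"
      using image_internal_direct_sum [OF N M k(1) inj(2) N.carrier_is_submodule, of A B] AB onto
      by simp
    have "?f \<in> module_hom R (M\<lparr>carrier := k ` A\<rparr>) (M\<lparr>carrier := k ` B\<rparr>)"
    proof -
      have "h \<in> module_hom R (M\<lparr>carrier := k ` A\<rparr>) (N\<lparr>carrier := A\<rparr>)"
        using h(1) hkA k(1) subset by (auto simp: module_hom_def subset_iff Pi_iff)
      moreover have "k \<in> module_hom R (N\<lparr>carrier := B\<rparr>) (M\<lparr>carrier := k ` B\<rparr>)"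
        using k(1) subset by (auto simp: module_hom_def subset_iff)
      ultimately show ?thesis
        using f by (auto simp: module_hom_def Pi_iff)
    qed
    then obtain C where C: "direct_summand R (M\<lparr>carrier := k ` B\<rparr>) C"
      and iso: "module_isomorphic R (M\<lparr>carrier := ?f ` k ` A\<rparr>) (M\<lparr>carrier := C\<rparr>)"
      using C4 sum unfolding C4_module_def by blast
    have kB: "submodule (k ` B) R M"
      using image_submodule [OF N M k(1) sub(2)] .
    from C obtain D where D: "internal_direct_sum R (M\<lparr>carrier := k ` B\<rparr>) C D"
      by (auto simp: direct_summand_def)
    then have "direct_summand R (N\<lparr>carrier := B\<rparr>) (h ` C)"
      using image_internal_direct_sum [OF M N h(1) inj(1) kB] hkB by (auto simp: direct_summand_def)
    moreover have "module_isomorphic R (N\<lparr>carrier := f ` A\<rparr>) (N\<lparr>carrier := h ` C\<rparr>)"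
    proof -
      have "?f ` k ` A = k ` f ` h ` k ` A"
        by (simp add: image_image)
      then have "?f ` k ` A = k ` f ` A"
        unfolding hkA .
      then have 1: "module_isomorphic R (N\<lparr>carrier := f ` A\<rparr>) (M\<lparr>carrier := ?f ` k ` A\<rparr>)"
        using module_isomorphic_image [OF k(1) inj(2), of "f ` A"] fA subset by auto
      have 2: "module_isomorphic R (M\<lparr>carrier := C\<rparr>) (N\<lparr>carrier := h ` C\<rparr>)"
        using D M.internal_direct_sum_submodule_iff [OF kB] M.submodule_iff
        by (intro module_isomorphic_image [OF h(1) inj(1)]) auto
      show ?thesis
        by (rule module_isomorphic_trans [OF module_isomorphic_trans [OF 1 iso] 2])
    qed
    ultimately show ?thesis by blast
  qed
  then show ?thesis
    using N by (simp add: C4_module_def)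
qed


section \<open>The localization is a module over the local ring\<close>

context prime_loc
begin

abbreviation "Q \<equiv> regular_module R"

lemma regular_loc: "prime_loc R Q p"
  using primeideal_axioms by (rule prime_loc_regular)

lemma one_notin [simp]: "\<one> \<notin> p"
  using S_one by blast

lemma mult_notin [simp]:
  "s \<in> carrier R \<Longrightarrow> s \<notin> p \<Longrightarrow> t \<in> carrier R \<Longrightarrow> t \<notin> p \<Longrightarrow> s \<otimes> t \<notin> p"
  using S_mult by blast

lemma frac_eqI:
  assumes "m \<in> carrier M" "n \<in> carrier M" "s \<in> S" "t \<in> S" "t \<odot>\<^bsub>M\<^esub> m = s \<odot>\<^bsub>M\<^esub> n"
  shows "frac R p M m s = frac R p M n t"
  using assms S_one by (auto simp: frac_eq_iff)

lemma frac_carrier: "m \<in> carrier M \<Longrightarrow> s \<in> S \<Longrightarrow> frac R p M m s \<in> carrier (loc_module R p M)"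
  by (auto simp: loc_carrier)

lemma loc_carrierE:
  assumes "x \<in> carrier (loc_module R p M)"
  obtains m s where "m \<in> carrier M" "s \<in> S" "x = frac R p M m s"
  using assms by (auto simp: loc_carrier)

lemma add_frac:
  assumes "m \<in> carrier M" "n \<in> carrier M" "s \<in> S" "t \<in> S"
  shows "frac R p M m s \<oplus>\<^bsub>loc_module R p M\<^esub> frac R p M n t =
    frac R p M (t \<odot>\<^bsub>M\<^esub> m \<oplus>\<^bsub>M\<^esub> s \<odot>\<^bsub>M\<^esub> n) (s \<otimes> t)"
  using loc_add_frac [OF assms] by (simp add: loc_module_def)

lemma smult_frac:
  assumes "a \<in> carrier R" "s \<in> S" "m \<in> carrier M" "t \<in> S"
  shows "frac R p Q a s \<odot>\<^bsub>loc_module R p M\<^esub> frac R p M m t = frac R p M (a \<odot>\<^bsub>M\<^esub> m) (s \<otimes> t)"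
  using loc_smult_frac [OF assms] by (simp add: loc_module_def)

lemma zero_frac: "\<zero>\<^bsub>loc_module R p M\<^esub> = frac R p M \<zero>\<^bsub>M\<^esub> \<one>"
  by (simp add: loc_module_def)

lemma frac_zero: "s \<in> S \<Longrightarrow> frac R p M \<zero>\<^bsub>M\<^esub> s = \<zero>\<^bsub>loc_module R p M\<^esub>"
  unfolding zero_frac using S_one by (intro frac_eqI) auto

lemma abelian_group_loc: "abelian_group (loc_module R p M)"
proof (rule abelian_groupI)
  note ac = smult_assoc1 [symmetric] m_ac smult_r_distr M.a_ac
  fix x assume "x \<in> carrier (loc_module R p M)"
  then obtain m s where x: "m \<in> carrier M" "s \<in> S" "x = frac R p M m s"
    by (rule loc_carrierE)
  show "\<zero>\<^bsub>loc_module R p M\<^esub> \<oplus>\<^bsub>loc_module R p M\<^esub> x = x"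
    using x by (simp add: zero_frac add_frac)
  have "frac R p M (\<ominus>\<^bsub>M\<^esub> m) s \<oplus>\<^bsub>loc_module R p M\<^esub> x = \<zero>\<^bsub>loc_module R p M\<^esub>"
    using x by (simp add: add_frac smult_r_minus M.l_neg frac_zero)
  then show "\<exists>y\<in>carrier (loc_module R p M). y \<oplus>\<^bsub>loc_module R p M\<^esub> x = \<zero>\<^bsub>loc_module R p M\<^esub>"
    using x by (intro bexI [of _ "frac R p M (\<ominus>\<^bsub>M\<^esub> m) s"]) (auto simp: frac_carrier)
  fix y assume "y \<in> carrier (loc_module R p M)"
  then obtain n t where y: "n \<in> carrier M" "t \<in> S" "y = frac R p M n t"
    by (rule loc_carrierE)
  have [simp]: "s \<in> carrier R" "t \<in> carrier R"
    using x y by auto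
  show "x \<oplus>\<^bsub>loc_module R p M\<^esub> y \<in> carrier (loc_module R p M)"
    using x y S_mult by (auto simp: add_frac intro!: frac_carrier)
  show "x \<oplus>\<^bsub>loc_module R p M\<^esub> y = y \<oplus>\<^bsub>loc_module R p M\<^esub> x"
    using x y S_mult by (simp add: add_frac ac)
  fix z assume "z \<in> carrier (loc_module R p M)"
  then obtain l r where z: "l \<in> carrier M" "r \<in> S" "z = frac R p M l r"
    by (rule loc_carrierE)
  have [simp]: "r \<in> carrier R"
    using z by auto
  show "x \<oplus>\<^bsub>loc_module R p M\<^esub> y \<oplus>\<^bsub>loc_module R p M\<^esub> z =
      x \<oplus>\<^bsub>loc_module R p M\<^esub> (y \<oplus>\<^bsub>loc_module R p M\<^esub> z)"
    using x y z S_mult by (simp add: add_frac ac)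
next
  show "\<zero>\<^bsub>loc_module R p M\<^esub> \<in> carrier (loc_module R p M)"
    using S_one by (simp add: zero_frac frac_carrier)
qed

end

text \<open>The additive group of the local ring is that of the localized regular module, and its
  multiplication is the scalar action on that module.\<close>

lemma loc_ring_sels:
  "carrier (loc_ring R p) = carrier (loc_module R p (regular_module R))"
  "mult (loc_ring R p) = smult (loc_module R p (regular_module R))"
  "one (loc_ring R p) = frac R p (regular_module R) \<one>\<^bsub>R\<^esub> \<one>\<^bsub>R\<^esub>"
  "zero (loc_ring R p) = zero (loc_module R p (regular_module R))"
  "add (loc_ring R p) = add (loc_module R p (regular_module R))"
  by (simp_all add: loc_ring_def loc_module_def Let_def) (simp_all add: regular_module_def)

context prime_loc
begin

lemma cring_loc_ring: "cring (loc_ring R p)"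
proof (rule cringI)
  interpret Q: prime_loc R Q p
    by (rule regular_loc)
  have [simp]: "carrier Q = carrier R" "smult Q = mult R" "add Q = add R"
    by (simp_all add: regular_module_def)
  show "abelian_group (loc_ring R p)"
  proof -
    interpret A: abelian_group "loc_module R p Q"
      by (rule Q.abelian_group_loc)
    show ?thesis
      by (rule abelian_groupI) (simp_all add: loc_ring_sels A.a_ac A.add.l_inv_ex [simplified])
  qed
  note simps = loc_ring_sels Q.smult_frac Q.add_frac
  show "comm_monoid (loc_ring R p)"
  proof (rule comm_monoidI)
    fix x assume "x \<in> carrier (loc_ring R p)"
    then obtain a s where x: "a \<in> carrier R" "s \<in> S" "x = frac R p Q a s"
      unfolding loc_ring_sels by (auto elim: Q.loc_carrierE)
    have [simp]: "s \<in> carrier R" using x by auto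
    show "\<one>\<^bsub>loc_ring R p\<^esub> \<otimes>\<^bsub>loc_ring R p\<^esub> x = x"
      using x by (simp add: simps)
    fix y assume "y \<in> carrier (loc_ring R p)"
    then obtain b t where y: "b \<in> carrier R" "t \<in> S" "y = frac R p Q b t"
      unfolding loc_ring_sels by (auto elim: Q.loc_carrierE)
    have [simp]: "t \<in> carrier R" using y by auto
    show "x \<otimes>\<^bsub>loc_ring R p\<^esub> y \<in> carrier (loc_ring R p)"
      using x y S_mult by (auto simp: simps intro!: Q.frac_carrier)
    show "x \<otimes>\<^bsub>loc_ring R p\<^esub> y = y \<otimes>\<^bsub>loc_ring R p\<^esub> x"
      using x y by (simp add: simps m_comm)
    fix z assume "z \<in> carrier (loc_ring R p)"
    then obtain c r where z: "c \<in> carrier R" "r \<in> S" "z = frac R p Q c r"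
      unfolding loc_ring_sels by (auto elim: Q.loc_carrierE)
    have [simp]: "r \<in> carrier R" using z by auto
    show "x \<otimes>\<^bsub>loc_ring R p\<^esub> y \<otimes>\<^bsub>loc_ring R p\<^esub> z = x \<otimes>\<^bsub>loc_ring R p\<^esub> (y \<otimes>\<^bsub>loc_ring R p\<^esub> z)"
      using x y z S_mult by (simp add: simps m_assoc)
  next
    show "\<one>\<^bsub>loc_ring R p\<^esub> \<in> carrier (loc_ring R p)"
      using S_one by (auto simp: loc_ring_sels intro!: Q.frac_carrier)
  qed
  fix x y z
  assume "x \<in> carrier (loc_ring R p)" "y \<in> carrier (loc_ring R p)" "z \<in> carrier (loc_ring R p)"
  then obtain a s b t c r where x: "a \<in> carrier R" "s \<in> S" "x = frac R p Q a s"
    and y: "b \<in> carrier R" "t \<in> S" "y = frac R p Q b t"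
    and z: "c \<in> carrier R" "r \<in> S" "z = frac R p Q c r"
    unfolding loc_ring_sels by (auto elim!: Q.loc_carrierE)
  have [simp]: "s \<in> carrier R" "t \<in> carrier R" "r \<in> carrier R" using x y z by auto
  show "(x \<oplus>\<^bsub>loc_ring R p\<^esub> y) \<otimes>\<^bsub>loc_ring R p\<^esub> z =
      x \<otimes>\<^bsub>loc_ring R p\<^esub> z \<oplus>\<^bsub>loc_ring R p\<^esub> y \<otimes>\<^bsub>loc_ring R p\<^esub> z"
    using x y z by (simp add: simps) (rule Q.frac_eqI, simp_all add: l_distr r_distr m_ac)
qed

lemma module_loc: "module (loc_ring R p) (loc_module R p M)"
proof (rule moduleI)
  interpret Q: prime_loc R Q p
    by (rule regular_loc)
  have [simp]: "carrier Q = carrier R" "smult Q = mult R" "add Q = add R"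
    by (simp_all add: regular_module_def)
  note simps = loc_ring_sels Q.smult_frac Q.add_frac smult_frac add_frac
  have elim: "\<exists>a s. a \<in> carrier R \<and> s \<in> S \<and> s \<in> carrier R \<and> x = frac R p Q a s"
    if "x \<in> carrier (loc_ring R p)" for x
    using that unfolding loc_ring_sels by (auto elim!: Q.loc_carrierE)
  show "cring (loc_ring R p)" "abelian_group (loc_module R p M)"
    by (rule cring_loc_ring abelian_group_loc)+
  fix x assume "x \<in> carrier (loc_module R p M)"
  then obtain m t where x: "m \<in> carrier M" "t \<in> S" "x = frac R p M m t"
    by (rule loc_carrierE)
  show "\<one>\<^bsub>loc_ring R p\<^esub> \<odot>\<^bsub>loc_module R p M\<^esub> x = x"
    using x S_one by (auto simp: simps)
  fix \<alpha> assume "\<alpha> \<in> carrier (loc_ring R p)"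
  then obtain a s where a: "a \<in> carrier R" "s \<in> S" "s \<in> carrier R" "\<alpha> = frac R p Q a s"
    using elim by blast
  show "\<alpha> \<odot>\<^bsub>loc_module R p M\<^esub> x \<in> carrier (loc_module R p M)"
    using x a S_mult by (auto simp: simps intro!: frac_carrier)
  {
    fix y assume "y \<in> carrier (loc_module R p M)"
    then obtain n r where y: "n \<in> carrier M" "r \<in> S" "y = frac R p M n r"
      by (rule loc_carrierE)
    show "\<alpha> \<odot>\<^bsub>loc_module R p M\<^esub> (x \<oplus>\<^bsub>loc_module R p M\<^esub> y) =
        \<alpha> \<odot>\<^bsub>loc_module R p M\<^esub> x \<oplus>\<^bsub>loc_module R p M\<^esub> \<alpha> \<odot>\<^bsub>loc_module R p M\<^esub> y"
      using x a y
      by (simp add: simps)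
        (rule frac_eqI, simp_all add: smult_r_distr smult_assoc1 [symmetric] m_ac)
  next
    fix \<beta> assume "\<beta> \<in> carrier (loc_ring R p)"
    then obtain b r where b: "b \<in> carrier R" "r \<in> S" "r \<in> carrier R" "\<beta> = frac R p Q b r"
      using elim by blast
    show "(\<alpha> \<oplus>\<^bsub>loc_ring R p\<^esub> \<beta>) \<odot>\<^bsub>loc_module R p M\<^esub> x =
        \<alpha> \<odot>\<^bsub>loc_module R p M\<^esub> x \<oplus>\<^bsub>loc_module R p M\<^esub> \<beta> \<odot>\<^bsub>loc_module R p M\<^esub> x"
      using x a b
      by (simp add: simps)
        (rule frac_eqI, simp_all add: smult_l_distr smult_r_distr smult_assoc1 [symmetric] m_ac)
    show "(\<alpha> \<otimes>\<^bsub>loc_ring R p\<^esub> \<beta>) \<odot>\<^bsub>loc_module R p M\<^esub> x =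
        \<alpha> \<odot>\<^bsub>loc_module R p M\<^esub> (\<beta> \<odot>\<^bsub>loc_module R p M\<^esub> x)"
      using x a b S_mult by (simp add: simps smult_assoc1 m_ac)
  }
qed


section \<open>Localized submodules and homomorphisms\<close>

lemma loc_submodule_memE:
  assumes "x \<in> loc_submodule R p M A"
  obtains a s where "a \<in> A" "s \<in> S" "x = frac R p M a s"
  using assms by (auto simp: loc_submodule_def)

lemma loc_submodule_mem: "a \<in> A \<Longrightarrow> s \<in> S \<Longrightarrow> frac R p M a s \<in> loc_submodule R p M A"
  by (auto simp: loc_submodule_def)

lemma loc_submodule_carrier: "loc_submodule R p M (carrier M) = carrier (loc_module R p M)"
  by (simp add: loc_submodule_def loc_carrier)

lemma submodule_loc_submodule:
  assumes "submodule A R M"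
  shows "submodule (loc_submodule R p M A) (loc_ring R p) (loc_module R p M)"
proof -
  interpret L: module "loc_ring R p" "loc_module R p M"
    by (rule module_loc)
  interpret Q: prime_loc R Q p
    by (rule regular_loc)
  have [simp]: "carrier Q = carrier R"
    by (simp add: regular_module_def)
  note A = assms [unfolded submodule_iff]
  then have mem: "a \<in> carrier M" if "a \<in> A" for a
    using that by blast
  show ?thesis
    unfolding L.submodule_iff
  proof (intro conjI ballI)
    show "loc_submodule R p M A \<subseteq> carrier (loc_module R p M)"
      using mem by (auto elim!: loc_submodule_memE intro: frac_carrier)
    show "\<zero>\<^bsub>loc_module R p M\<^esub> \<in> loc_submodule R p M A"
      using A S_one by (auto simp: zero_frac intro: loc_submodule_mem)
  next
    fix x y assume "x \<in> loc_submodule R p M A" "y \<in> loc_submodule R p M A"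
    then obtain a s b t where "a \<in> A" "s \<in> S" "x = frac R p M a s"
      "b \<in> A" "t \<in> S" "y = frac R p M b t"
      by (auto elim!: loc_submodule_memE)
    then show "x \<oplus>\<^bsub>loc_module R p M\<^esub> y \<in> loc_submodule R p M A"
      using A mem S_mult by (auto simp: add_frac intro!: loc_submodule_mem)
  next
    fix r x assume "r \<in> carrier (loc_ring R p)" "x \<in> loc_submodule R p M A"
    then obtain a s b t where "a \<in> A" "s \<in> S" "x = frac R p M a s"
      "b \<in> carrier R" "t \<in> S" "r = frac R p Q b t"
      unfolding loc_ring_sels by (auto elim!: loc_submodule_memE Q.loc_carrierE)
    then show "r \<odot>\<^bsub>loc_module R p M\<^esub> x \<in> loc_submodule R p M A"
      using A mem S_mult by (auto simp: smult_frac intro!: loc_submodule_mem)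
  qed
qed

text \<open>Sums localize because \<open>(a + b)/s = a/s + b/s\<close>, and conversely \<open>a/s + b/t\<close> has numerator
  \<open>t a + s b\<close>.\<close>

lemma loc_submodule_set_add:
  assumes "submodule A R M" "submodule B R M"
  shows "loc_submodule R p M (A <+>\<^bsub>M\<^esub> B) =
    loc_submodule R p M A <+>\<^bsub>loc_module R p M\<^esub> loc_submodule R p M B"
proof -
  note AB = assms [unfolded submodule_iff]
  then have mem: "a \<in> carrier M" if "a \<in> A \<or> a \<in> B" for a
    using that by blast
  show ?thesis
  proof (intro subset_antisym subsetI)
    fix x assume "x \<in> loc_submodule R p M (A <+>\<^bsub>M\<^esub> B)"
    then obtain a b s where x: "a \<in> A" "b \<in> B" "s \<in> S" "x = frac R p M (a \<oplus>\<^bsub>M\<^esub> b) s"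
      by (auto simp: set_add_def' elim!: loc_submodule_memE)
    have "x = frac R p M a s \<oplus>\<^bsub>loc_module R p M\<^esub> frac R p M b s"
    proof -
      have "frac R p M (a \<oplus>\<^bsub>M\<^esub> b) s = frac R p M (s \<odot>\<^bsub>M\<^esub> a \<oplus>\<^bsub>M\<^esub> s \<odot>\<^bsub>M\<^esub> b) (s \<otimes> s)"
        using x mem S_mult by (intro frac_eqI) (auto simp: smult_r_distr smult_assoc1)
      then show ?thesis
        using x mem by (simp add: add_frac)
    qed
    then show "x \<in> loc_submodule R p M A <+>\<^bsub>loc_module R p M\<^esub> loc_submodule R p M B"
      using x by (auto simp: set_add_def' intro!: bexI loc_submodule_mem)
  next
    fix x assume "x \<in> loc_submodule R p M A <+>\<^bsub>loc_module R p M\<^esub> loc_submodule R p M B"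
    then obtain a s b t where x: "a \<in> A" "s \<in> S" "b \<in> B" "t \<in> S"
      "x = frac R p M a s \<oplus>\<^bsub>loc_module R p M\<^esub> frac R p M b t"
      by (auto simp: set_add_def' elim!: loc_submodule_memE)
    have "t \<odot>\<^bsub>M\<^esub> a \<oplus>\<^bsub>M\<^esub> s \<odot>\<^bsub>M\<^esub> b \<in> A <+>\<^bsub>M\<^esub> B"
      using x AB unfolding set_add_def' by blast
    then show "x \<in> loc_submodule R p M (A <+>\<^bsub>M\<^esub> B)"
      using x mem S_mult by (auto simp: add_frac intro!: loc_submodule_mem)
  qed
qed

text \<open>If \<open>a/s = b/t\<close>, then \<open>u t a = u s b\<close> for some \<open>u\<close> outside \<open>p\<close>, and this element of the
  intersection vanishes; hence so does \<open>a/s\<close>.\<close>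

lemma loc_submodule_Int_zero:
  assumes "submodule A R M" "submodule B R M" "A \<inter> B = {\<zero>\<^bsub>M\<^esub>}"
  shows "loc_submodule R p M A \<inter> loc_submodule R p M B = {\<zero>\<^bsub>loc_module R p M\<^esub>}"
proof -
  note AB = assms(1,2) [unfolded submodule_iff]
  then have mem: "a \<in> carrier M" if "a \<in> A \<or> a \<in> B" for a
    using that by blast
  have "x = \<zero>\<^bsub>loc_module R p M\<^esub>" if "x \<in> loc_submodule R p M A" "x \<in> loc_submodule R p M B" for x
  proof -
    obtain a s b t where x: "a \<in> A" "s \<in> S" "b \<in> B" "t \<in> S" "x = frac R p M a s"
      "x = frac R p M b t"
      using \<open>x \<in> loc_submodule R p M A\<close> \<open>x \<in> loc_submodule R p M B\<close>
      by (auto elim!: loc_submodule_memE)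
    then obtain u where u: "u \<in> S" "u \<odot>\<^bsub>M\<^esub> (t \<odot>\<^bsub>M\<^esub> a) = u \<odot>\<^bsub>M\<^esub> (s \<odot>\<^bsub>M\<^esub> b)"
      using mem frac_eq_iff [of a b s t] by auto
    have "u \<odot>\<^bsub>M\<^esub> (t \<odot>\<^bsub>M\<^esub> a) \<in> A" "u \<odot>\<^bsub>M\<^esub> (s \<odot>\<^bsub>M\<^esub> b) \<in> B"
      using x u(1) AB by auto
    then have "u \<odot>\<^bsub>M\<^esub> (t \<odot>\<^bsub>M\<^esub> a) = \<zero>\<^bsub>M\<^esub>"
      using u(2) assms(3) by auto
    then have "(u \<otimes> t) \<odot>\<^bsub>M\<^esub> a = s \<odot>\<^bsub>M\<^esub> \<zero>\<^bsub>M\<^esub>"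
      using x u mem by (simp add: smult_assoc1)
    then have "frac R p M a s = frac R p M \<zero>\<^bsub>M\<^esub> (u \<otimes> t)"
      using x u mem S_mult by (intro frac_eqI) auto
    then show ?thesis
      using x u S_mult by (simp add: frac_zero)
  qed
  moreover have "\<zero>\<^bsub>loc_module R p M\<^esub> \<in> loc_submodule R p M A \<inter> loc_submodule R p M B"
    using AB S_one by (auto simp: zero_frac intro: loc_submodule_mem)
  ultimately show ?thesis by blast
qed

lemma internal_direct_sum_loc:
  assumes "submodule L R M" "internal_direct_sum R (M\<lparr>carrier := L\<rparr>) A B"
  shows "internal_direct_sum (loc_ring R p) ((loc_module R p M)\<lparr>carrier := loc_submodule R p M L\<rparr>)
    (loc_submodule R p M A) (loc_submodule R p M B)"
proof -
  interpret L: module "loc_ring R p" "loc_module R p M"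
    by (rule module_loc)
  show ?thesis
    using assms(2) loc_submodule_set_add loc_submodule_Int_zero submodule_loc_submodule
    unfolding internal_direct_sum_submodule_iff [OF assms(1)]
      L.internal_direct_sum_submodule_iff [OF submodule_loc_submodule [OF assms(1)]]
    by metis
qed

end

text \<open>A fraction is the class of its representatives \<open>(m, s)\<close>; for a homomorphism \<open>f\<close> they all
  give the same class \<open>f(m)/s\<close>, so the union is that class.\<close>

definition loc_map ::
  "('a, 'r) ring_scheme \<Rightarrow> 'a set \<Rightarrow> ('a, 'c, 'n) module_scheme \<Rightarrow> ('b \<Rightarrow> 'c) \<Rightarrow>
    ('b \<times> 'a) set \<Rightarrow> ('c \<times> 'a) set"
  where "loc_map R p N f X = (\<Union>(m, s)\<in>X. frac R p N (f m) s)"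

locale prime_loc_hom = M: prime_loc R M p + N: prime_loc R N p for R M N p +
  fixes f
  assumes hom: "f \<in> module_hom R M N"
begin

lemma loc_map_frac:
  assumes "m \<in> carrier M" "s \<in> M.S"
  shows "loc_map R p N f (frac R p M m s) = frac R p N (f m) s"
proof -
  have "frac R p N (f m') s' = frac R p N (f m) s" if m': "(m', s') \<in> frac R p M m s" for m' s'
  proof -
    note c = assms M.mem_frac(1,2) [OF m']
    obtain u where u: "u \<in> M.S" "u \<odot>\<^bsub>M\<^esub> (s' \<odot>\<^bsub>M\<^esub> m) = u \<odot>\<^bsub>M\<^esub> (s \<odot>\<^bsub>M\<^esub> m')"
      using M.mem_frac(3) [OF m'] by blast
    then have "f (u \<odot>\<^bsub>M\<^esub> (s' \<odot>\<^bsub>M\<^esub> m)) = f (u \<odot>\<^bsub>M\<^esub> (s \<odot>\<^bsub>M\<^esub> m'))"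
      by simp
    then have "u \<odot>\<^bsub>N\<^esub> (s' \<odot>\<^bsub>N\<^esub> f m) = u \<odot>\<^bsub>N\<^esub> (s \<odot>\<^bsub>N\<^esub> f m')"
      using c u(1) hom by (simp add: module_hom_smult)
    then show ?thesis
      using c u(1) module_hom_mem [OF hom] N.frac_eq_iff [of "f m" "f m'" s s'] by metis
  qed
  then show ?thesis
    using M.frac_self [OF assms] unfolding loc_map_def by blast
qed

lemma loc_map_hom: "loc_map R p N f \<in> module_hom (loc_ring R p) (loc_module R p M) (loc_module R p N)"
proof -
  interpret Q: prime_loc R "regular_module R" p
    by (rule M.regular_loc)
  have [simp]: "carrier (regular_module R) = carrier R"
    by (simp add: regular_module_def)
  have "loc_map R p N f x \<in> carrier (loc_module R p N)" if "x \<in> carrier (loc_module R p M)" for x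
    using that hom
    by (auto simp: loc_map_frac module_hom_mem elim!: M.loc_carrierE intro!: N.frac_carrier)
  moreover have "loc_map R p N f (x \<oplus>\<^bsub>loc_module R p M\<^esub> y) =
      loc_map R p N f x \<oplus>\<^bsub>loc_module R p N\<^esub> loc_map R p N f y"
    if "x \<in> carrier (loc_module R p M)" "y \<in> carrier (loc_module R p M)" for x y
    using that hom M.S_mult
    by (auto simp: loc_map_frac M.add_frac N.add_frac module_hom_add module_hom_smult
        module_hom_mem elim!: M.loc_carrierE)
  moreover have "loc_map R p N f (r \<odot>\<^bsub>loc_module R p M\<^esub> x) =
      r \<odot>\<^bsub>loc_module R p N\<^esub> loc_map R p N f x"
    if "r \<in> carrier (loc_ring R p)" "x \<in> carrier (loc_module R p M)" for r x
    using that hom M.S_mult unfolding loc_ring_sels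
    by (auto simp: loc_map_frac M.smult_frac N.smult_frac module_hom_smult module_hom_mem
        elim!: M.loc_carrierE Q.loc_carrierE)
  ultimately show ?thesis
    by (auto simp: module_hom_def)
qed

text \<open>If \<open>f(m)/s = f(n)/t\<close>, then \<open>f(u t m) = f(u s n)\<close> for some \<open>u\<close> outside \<open>p\<close>, and \<open>f\<close> can be
  cancelled: the same \<open>u\<close> shows \<open>m/s = n/t\<close>.\<close>

lemma inj_on_loc_map:
  assumes "inj_on f (carrier M)"
  shows "inj_on (loc_map R p N f) (carrier (loc_module R p M))"
proof (rule inj_onI)
  fix x y assume "x \<in> carrier (loc_module R p M)" "y \<in> carrier (loc_module R p M)"
    and eq: "loc_map R p N f x = loc_map R p N f y"
  then obtain m s n t where x: "m \<in> carrier M" "s \<in> M.S" "x = frac R p M m s"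
    and y: "n \<in> carrier M" "t \<in> M.S" "y = frac R p M n t"
    by (auto elim!: M.loc_carrierE)
  then obtain u where u: "u \<in> M.S" "u \<odot>\<^bsub>N\<^esub> (t \<odot>\<^bsub>N\<^esub> f m) = u \<odot>\<^bsub>N\<^esub> (s \<odot>\<^bsub>N\<^esub> f n)"
    using eq hom N.frac_eq_iff [of "f m" "f n" s t] by (auto simp: loc_map_frac module_hom_mem)
  then have "f (u \<odot>\<^bsub>M\<^esub> (t \<odot>\<^bsub>M\<^esub> m)) = f (u \<odot>\<^bsub>M\<^esub> (s \<odot>\<^bsub>M\<^esub> n))"
    using x y hom by (simp add: module_hom_smult)
  then have "u \<odot>\<^bsub>M\<^esub> (t \<odot>\<^bsub>M\<^esub> m) = u \<odot>\<^bsub>M\<^esub> (s \<odot>\<^bsub>M\<^esub> n)"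
    using x y u(1) by (intro inj_onD [OF assms]) auto
  then show "x = y"
    using x y u(1) M.frac_eq_iff by blast
qed

lemma loc_map_image:
  assumes "A \<subseteq> carrier M"
  shows "loc_map R p N f ` loc_submodule R p M A = loc_submodule R p N (f ` A)"
proof -
  have "loc_map R p N f (frac R p M a s) = frac R p N (f a) s" if "a \<in> A" "s \<in> M.S" for a s
    using that assms by (intro loc_map_frac) auto
  then show ?thesis
    unfolding loc_submodule_def by (force simp: image_iff)
qed

end

context prime_loc
begin

text \<open>The classes that make up the localization of \<open>A\<close> as a module are smaller than those that
  make up its localization inside that of \<open>M\<close>, since they contain only pairs with numerators in
  \<open>A\<close>.  Localizing the inclusion identifies the two.\<close>

lemma loc_submodule_isomorphic:
  assumes "submodule A R M"
  shows "module_isomorphic (loc_ring R p) (loc_module R p (M\<lparr>carrier := A\<rparr>))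
    ((loc_module R p M)\<lparr>carrier := loc_submodule R p M A\<rparr>)"
proof -
  have sub: "A \<subseteq> carrier M"
    using assms by (simp add: submodule_iff)
  interpret A: prime_loc R "M\<lparr>carrier := A\<rparr>" p
    using submodule.submodule_is_module [OF assms module_axioms] primeideal_axioms
    by (simp add: prime_loc_def)
  interpret inc: prime_loc_hom R "M\<lparr>carrier := A\<rparr>" M p "\<lambda>x. x"
    by unfold_locales (use sub in \<open>auto simp: module_hom_def\<close>)
  have "loc_map R p M (\<lambda>x. x) ` carrier (loc_module R p (M\<lparr>carrier := A\<rparr>)) = loc_submodule R p M A"
    using inc.loc_map_image [of A] A.loc_submodule_carrier by simp
  then show ?thesis
    using module_isomorphic_image [OF inc.loc_map_hom inc.inj_on_loc_map subset_refl] by simp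
qed

lemma module_isomorphic_loc:
  assumes "module R N" "module_isomorphic R M N"
  shows "module_isomorphic (loc_ring R p) (loc_module R p M) (loc_module R p N)"
proof -
  obtain h where h: "h \<in> module_hom R M N" "bij_betw h (carrier M) (carrier N)"
    using assms(2) by (auto simp: module_isomorphic_def)
  interpret N: prime_loc R N p
    using assms(1) primeideal_axioms by (simp add: prime_loc_def)
  interpret h: prime_loc_hom R M N p h
    by unfold_locales (rule h)
  have "loc_map R p N h ` carrier (loc_module R p M) = carrier (loc_module R p N)"
    using h.loc_map_image [OF subset_refl] loc_submodule_carrier N.loc_submodule_carrier h(2)
    by (simp add: bij_betw_def)
  then show ?thesis
    using h.loc_map_hom h.inj_on_loc_map h(2)
    unfolding module_isomorphic_def bij_betw_def by blast
qed

text \<open>The isomorphism is the composite of three: from \<open>A\<^sub>p\<close> inside \<open>M\<^sub>p\<close> to the localization of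
  the module \<open>A\<close>, on to that of \<open>B\<close>, and back into \<open>M\<^sub>p\<close>.\<close>

lemma loc_submodules_isomorphic:
  assumes A: "submodule A R M" and B: "submodule B R M"
    and iso: "module_isomorphic R (M\<lparr>carrier := A\<rparr>) (M\<lparr>carrier := B\<rparr>)"
  shows "module_isomorphic (loc_ring R p) ((loc_module R p M)\<lparr>carrier := loc_submodule R p M A\<rparr>)
    ((loc_module R p M)\<lparr>carrier := loc_submodule R p M B\<rparr>)"
proof -
  interpret A: prime_loc R "M\<lparr>carrier := A\<rparr>" p
    using submodule.submodule_is_module [OF A module_axioms] primeideal_axioms
    by (simp add: prime_loc_def)
  have mB: "module R (M\<lparr>carrier := B\<rparr>)"
    using B module_axioms by (rule submodule.submodule_is_module)
  show ?thesis
    using module_isomorphic_sym [OF A.module_loc loc_submodule_isomorphic [OF A]]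
      A.module_isomorphic_loc [OF mB iso] loc_submodule_isomorphic [OF B]
    by (rule module_isomorphic_trans [OF _ module_isomorphic_trans])
qed


section \<open>Localization of the C4-property\<close>

text \<open>The lifting hypotheses replace a decomposition of the localization and a map \<open>g\<close> between its
  parts by the localizations of a decomposition \<open>M = A \<oplus> B\<close> and of \<open>f : A \<rightarrow> B\<close>.  The image
  of \<open>g\<close> is then the localization of that of \<open>f\<close>, and localizing \<open>f(A) \<cong> C\<close> and
  \<open>B = C \<oplus> D\<close> gives the summand required.\<close>

lemma C4_module_loc:
  assumes C4: "C4_module R M" and dec: "decomposition_lifting R p M"
    and mor: "morphism_lifting R p M"
  shows "C4_module (loc_ring R p) (loc_module R p M)"
proof -
  let ?loc = "loc_submodule R p M" and ?Mp = "loc_module R p M"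
  have "\<exists>C. direct_summand (loc_ring R p) (?Mp\<lparr>carrier := V\<rparr>) C \<and>
            module_isomorphic (loc_ring R p) (?Mp\<lparr>carrier := g ` U\<rparr>) (?Mp\<lparr>carrier := C\<rparr>)"
    if UV: "internal_direct_sum (loc_ring R p) ?Mp U V"
      and g: "g \<in> module_hom (loc_ring R p) (?Mp\<lparr>carrier := U\<rparr>) (?Mp\<lparr>carrier := V\<rparr>)" for U V g
  proof -
    obtain A B where AB: "internal_direct_sum R M A B" and U: "U = ?loc A" and V: "V = ?loc B"
      using dec UV unfolding decomposition_lifting_def by blast
    obtain f where f: "f \<in> module_hom R (M\<lparr>carrier := A\<rparr>) (M\<lparr>carrier := B\<rparr>)"
      and gf: "\<forall>a\<in>A. \<forall>s\<in>S. g (frac R p M a s) = frac R p M (f a) s"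
      using mor AB g unfolding morphism_lifting_def U V by blast
    obtain C where C: "direct_summand R (M\<lparr>carrier := B\<rparr>) C"
      and iso: "module_isomorphic R (M\<lparr>carrier := f ` A\<rparr>) (M\<lparr>carrier := C\<rparr>)"
      using C4 AB f unfolding C4_module_def by blast
    have A: "submodule A R M" and B: "submodule B R M"
      using AB by (auto simp: internal_direct_sum_def)
    obtain D where D: "internal_direct_sum R (M\<lparr>carrier := B\<rparr>) C D"
      using C by (auto simp: direct_summand_def)
    then have "submodule C R M"
      by (simp add: internal_direct_sum_submodule_iff [OF B])
    moreover have "submodule (f ` A) R M"
    proof -
      have mA: "module R (M\<lparr>carrier := A\<rparr>)" and mB: "module R (M\<lparr>carrier := B\<rparr>)"
        using A B module_axioms by (auto intro: submodule.submodule_is_module)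
      have "submodule (f ` A) R (M\<lparr>carrier := B\<rparr>)"
        using image_submodule [OF mA mB f] module.carrier_is_submodule [OF mA] by fastforce
      then show ?thesis
        by (simp add: submodule_of_submodule_iff [OF B])
    qed
    moreover have "g ` ?loc A = ?loc (f ` A)"
      using gf unfolding loc_submodule_def by (force simp: image_iff)
    ultimately have "module_isomorphic (loc_ring R p) (?Mp\<lparr>carrier := g ` U\<rparr>)
        (?Mp\<lparr>carrier := ?loc C\<rparr>)"
      using loc_submodules_isomorphic iso U by simp
    moreover have "direct_summand (loc_ring R p) (?Mp\<lparr>carrier := V\<rparr>) (?loc C)"
      using internal_direct_sum_loc [OF B D] V by (auto simp: direct_summand_def)
    ultimately show ?thesis by blast
  qed
  then show ?thesis
    using module_loc by (simp add: C4_module_def)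
qed

end

theorem theorem3p6:
  fixes R :: "('a, 'r) ring_scheme" and M :: "('a, 'b, 'm) module_scheme" and p :: "'a set"
  assumes "cring R"
    and "C4star_module R M"
    and "primeideal p R"
    and "submodule_lifting R p M"
    and "\<And>N. submodule N R M \<Longrightarrow> decomposition_lifting R p (M\<lparr>carrier := N\<rparr>)"
    and "\<And>N. submodule N R M \<Longrightarrow> morphism_lifting R p (M\<lparr>carrier := N\<rparr>)"
  shows "C4star_module (loc_ring R p) (loc_module R p M)"
proof -
  have M: "module R M"
    using assms(2) by (simp add: C4star_module_def)
  interpret prime_loc R M p
    using M assms(3) by (simp add: prime_loc_def)
  have "C4_module (loc_ring R p) ((loc_module R p M)\<lparr>carrier := X\<rparr>)"
    if X: "submodule X (loc_ring R p) (loc_module R p M)" for X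
  proof -
    obtain N where N: "submodule N R M" and XN: "X = loc_submodule R p M N"
      using assms(4) X unfolding submodule_lifting_def by blast
    interpret N: prime_loc R "M\<lparr>carrier := N\<rparr>" p
      using submodule.submodule_is_module [OF N M] assms(3) by (simp add: prime_loc_def)
    have "C4_module R (M\<lparr>carrier := N\<rparr>)"
      using assms(2) N by (simp add: C4star_module_def)
    then have "C4_module (loc_ring R p) (loc_module R p (M\<lparr>carrier := N\<rparr>))"
      using assms(5,6) N by (intro N.C4_module_loc) auto
    then show ?thesis
      using submodule.submodule_is_module [OF X module_loc] loc_submodule_isomorphic [OF N]
      unfolding XN by (rule C4_module_isomorphic)
  qed
  then show ?thesis
    using module_loc by (simp add: C4star_module_def)
qed

end
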